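(* Suppose $\nu\propto e^{-f}$ on $\mathbb R^d$ is $\alpha$-strongly log-concave and $L$-smooth for some $0<\alpha\le L<\infty$. Let $X_k\sim\rho_k$ evolve according to $X_{k+1}=X_k-\eta\nabla f(X_k)+\sqrt{2\eta}Z_k$ ($Z_k\sim\mathcal N(0,I)$ independent) with step-size $0<\eta\le1/L$ from $X_0\sim\rho_0$ with finite second moment. Let $\gamma=1-\alpha\eta\in(0,1)$ and let $\rho_{0,k}$ be the joint law of $(X_0,X_k)$. Then for all $k\ge1$, $$\mathsf{MI}(\rho_{0,k})\le\frac{\alpha\,\gamma^{2k}}{1-\gamma^{2k}}\mathrm{Var}(X_0).$$
   Context: $\mathsf{KL}(\mu\|\nu)=\int\log\frac{d\mu}{d\nu}\,d\mu$. The standard mutual information of a joint law $\rho^{XY}$ is $\mathsf{MI}(\rho^{XY})=\mathsf{KL}(\rho^{XY}\|\rho^X\otimes\rho^Y)$. $\mathrm{Var}(X_0)=\mathbb E\|X_0-\mathbb EX_0\|^2$. $\nu\propto e^{-f}$ with $f\in C^2$ is $\alpha$-strongly log-concave if $\nabla^2f\succeq\alpha I$ and $L$-smooth if $-LI\preceq\nabla^2f\preceq LI$. *)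

theory Defs
  imports "HOL-Probability.Probability"
begin

definition KL :: "'a measure \<Rightarrow> 'a measure \<Rightarrow> ereal" where
  "KL \<mu> \<nu> =
     (if absolutely_continuous \<nu> \<mu> \<and> sets \<mu> = sets \<nu> \<and>
         integrable \<mu> (\<lambda>x. ln (enn2real (RN_deriv \<nu> \<mu> x)))
      then ereal (\<integral>x. ln (enn2real (RN_deriv \<nu> \<mu> x)) \<partial>\<mu>)
      else \<infinity>)"

definition MI :: "'a measure \<Rightarrow> 'b measure \<Rightarrow> ('a \<times> 'b) measure \<Rightarrow> ereal" where
  "MI A B \<rho> = KL \<rho> (distr \<rho> A fst \<Otimes>\<^sub>M distr \<rho> B snd)"

definition std_gauss_density :: "'a::euclidean_space \<Rightarrow> real" where
  "std_gauss_density x = (2 * pi) powr (- real DIM('a) / 2) * exp (- (norm x)\<^sup>2 / 2)"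

end

theory Submission
  imports Defs "HOL-Real_Asymp.Real_Asymp"
begin

text \<open>The dual form of a relative entropy bound between the \<open>k\<close>-step laws started at \<open>x\<close> and \<open>y\<close> is
  the log-Harnack inequality \<open>P\<^sup>k \<phi> x \<le> ln (P\<^sup>k e\<^sup>\<phi> y) + C\<^sub>k \<parallel>x - y\<parallel>\<^sup>2\<close> for bounded \<open>\<phi>\<close>. The gradient step
  \<open>G x = x - \<eta> \<nabla>f x\<close> is \<open>\<gamma>\<close>-Lipschitz, being the gradient of a function with Hessian between \<open>0\<close> and
  \<open>\<gamma> I\<close>; one Gaussian shift moves a fraction of \<open>G x - G y\<close> away, the rest is treated by
  induction, and a suitable choice of the fraction gives \<open>C\<^sub>k = \<alpha> \<gamma>\<^sup>2\<^sup>k / (2 (1 - \<gamma>\<^sup>2\<^sup>k))\<close>. Applying the inequality to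
  \<open>\<phi>(x, \<cdot>)\<close> and integrating over independent \<open>x\<close> and \<open>y\<close> with the law of \<open>X\<^sub>0\<close> turns it into the
  Donsker--Varadhan form of the mutual information bound, with \<open>E \<parallel>x - y\<parallel>\<^sup>2 = 2 Var X\<^sub>0\<close>.\<close>

section \<open>Gradient maps with Hessian between \<open>0\<close> and \<open>c\<close>\<close>

text \<open>Bounds on the quadratic form of \<open>D x\<close> are transferred to \<open>G\<close>
  through the potential \<open>\<phi>\<close>. Along lines they place \<open>\<phi>\<close> above
  its tangents and below tangent plus \<open>c / 2\<close> times the squared distance; comparing the
  two bounds at well-chosen points controls \<open>G x - G y\<close> in every direction.\<close>

lemma lipschitz_if_derivative_between:
  fixes \<phi> :: "'a::euclidean_space \<Rightarrow> real" and G :: "'a \<Rightarrow> 'a" and D :: "'a \<Rightarrow> 'a \<Rightarrow> 'a"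
  assumes \<phi>: "\<And>x. (\<phi> has_derivative (\<lambda>h. G x \<bullet> h)) (at x)"
    and G: "\<And>x. (G has_derivative D x) (at x)"
    and lower: "\<And>x v. 0 \<le> v \<bullet> D x v"
    and upper: "\<And>x v. v \<bullet> D x v \<le> c * (norm v)\<^sup>2"
  shows "norm (G x - G y) \<le> c * norm (x - y)"
proof -
  have line: "0 \<le> (G (x + t *\<^sub>R v) - G x) \<bullet> v \<and> (G (x + t *\<^sub>R v) - G x) \<bullet> v \<le> c * t * (norm v)\<^sup>2"
    if "0 \<le> t" for x v and t :: real
  proof (cases "t = 0")
    case False
    with that have t: "0 < t" by simp
    have d: "((\<lambda>s. G (x + s *\<^sub>R v) \<bullet> v) has_derivative (\<lambda>h. h * (D (x + s *\<^sub>R v) v \<bullet> v))) (at s)" for s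
    proof -
      have "((\<lambda>s. G (x + s *\<^sub>R v)) has_derivative (\<lambda>h. D (x + s *\<^sub>R v) (h *\<^sub>R v))) (at s)"
        by (rule has_derivative_compose[OF _ G]) (auto intro!: derivative_eq_intros)
      then have "((\<lambda>s. G (x + s *\<^sub>R v) \<bullet> v) has_derivative (\<lambda>h. D (x + s *\<^sub>R v) (h *\<^sub>R v) \<bullet> v)) (at s)"
        by (rule has_derivative_inner_left)
      moreover have "D (x + s *\<^sub>R v) (h *\<^sub>R v) = h *\<^sub>R D (x + s *\<^sub>R v) v" for h
        using has_derivative_linear[OF G] by (simp add: linear_scale)
      ultimately show ?thesis by simp
    qed
    have "((\<lambda>s. G (x + s *\<^sub>R v) \<bullet> v) has_real_derivative (D (x + s *\<^sub>R v) v \<bullet> v)) (at s)" for s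
      unfolding has_field_derivative_def
      by (rule has_derivative_eq_rhs[OF d]) (simp add: fun_eq_iff mult.commute)
    from MVT2[OF t this] obtain s where
      "G (x + t *\<^sub>R v) \<bullet> v - G (x + 0 *\<^sub>R v) \<bullet> v = (t - 0) * (D (x + s *\<^sub>R v) v \<bullet> v)" by blast
    then have e: "(G (x + t *\<^sub>R v) - G x) \<bullet> v = t * (v \<bullet> D (x + s *\<^sub>R v) v)"
      by (simp add: inner_diff_right inner_commute)
    show ?thesis unfolding e
      using lower[of v "x + s *\<^sub>R v"] mult_left_mono[OF upper[of v "x + s *\<^sub>R v"] that] t
      by (simp add: mult_ac)
  qed simp
  have dphi: "((\<lambda>t. \<phi> (x + t *\<^sub>R v)) has_real_derivative (G (x + t *\<^sub>R v) \<bullet> v)) (at t)" for x v t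
  proof -
    have d: "((\<lambda>s. \<phi> (x + s *\<^sub>R v)) has_derivative (\<lambda>h. G (x + t *\<^sub>R v) \<bullet> (h *\<^sub>R v))) (at t)"
      by (rule has_derivative_compose[OF _ \<phi>]) (auto intro!: derivative_eq_intros)
    show ?thesis unfolding has_field_derivative_def
      by (rule has_derivative_eq_rhs[OF d]) (simp add: fun_eq_iff mult.commute)
  qed
  have lo: "\<phi> x + G x \<bullet> v \<le> \<phi> (x + v)" for x v
  proof -
    have d: "((\<lambda>t. \<phi> (x + t *\<^sub>R v) - t * (G x \<bullet> v)) has_real_derivative (G (x + t *\<^sub>R v) - G x) \<bullet> v) (at t)" for t
      by (auto intro!: derivative_eq_intros dphi simp: inner_diff_left)
    have "\<phi> (x + 0 *\<^sub>R v) - 0 * (G x \<bullet> v) \<le> \<phi> (x + 1 *\<^sub>R v) - 1 * (G x \<bullet> v)"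
    proof (rule DERIV_nonneg_imp_nondecreasing[where f = "\<lambda>t. \<phi> (x + t *\<^sub>R v) - t * (G x \<bullet> v)"])
      fix t :: real assume "0 \<le> t"
      then have "0 \<le> (G (x + t *\<^sub>R v) - G x) \<bullet> v" using line by blast
      with d[of t] show "\<exists>y. ((\<lambda>t. \<phi> (x + t *\<^sub>R v) - t * (G x \<bullet> v)) has_real_derivative y) (at t) \<and> 0 \<le> y"
        by (intro exI conjI)
    qed simp
    then show ?thesis by simp
  qed
  have up: "\<phi> (x + v) \<le> \<phi> x + G x \<bullet> v + c / 2 * (norm v)\<^sup>2" for x v
  proof -
    have d: "((\<lambda>t. \<phi> (x + t *\<^sub>R v) - t * (G x \<bullet> v) - c / 2 * t\<^sup>2 * (norm v)\<^sup>2) has_real_derivative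
        ((G (x + t *\<^sub>R v) - G x) \<bullet> v - c * t * (norm v)\<^sup>2)) (at t)" for t
      by (auto intro!: derivative_eq_intros dphi simp: inner_diff_left)
    have "\<phi> (x + 0 *\<^sub>R v) - 0 * (G x \<bullet> v) - c / 2 * 0\<^sup>2 * (norm v)\<^sup>2
        \<ge> \<phi> (x + 1 *\<^sub>R v) - 1 * (G x \<bullet> v) - c / 2 * 1\<^sup>2 * (norm v)\<^sup>2"
    proof (rule DERIV_nonpos_imp_nonincreasing[where
            f = "\<lambda>t. \<phi> (x + t *\<^sub>R v) - t * (G x \<bullet> v) - c / 2 * t\<^sup>2 * (norm v)\<^sup>2"])
      fix t :: real assume "0 \<le> t"
      then have "(G (x + t *\<^sub>R v) - G x) \<bullet> v - c * t * (norm v)\<^sup>2 \<le> 0" using line by fastforce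
      with d[of t] show "\<exists>y. ((\<lambda>t. \<phi> (x + t *\<^sub>R v) - t * (G x \<bullet> v) - c / 2 * t\<^sup>2 * (norm v)\<^sup>2)
          has_real_derivative y) (at t) \<and> y \<le> 0"
        by (intro exI conjI)
    qed simp
    then show ?thesis by simp
  qed
  define e where "e = G x - G y"
  \<comment> \<open>Both gradient inequalities at the competitors \<open>y + v\<close> and \<open>x - v\<close>, added.\<close>
  have key: "2 * (e \<bullet> v) \<le> c * (norm v)\<^sup>2 + e \<bullet> (x - y)" for v
    using lo[of x "y + v - x"] up[of y v] lo[of y "x - v - y"] up[of x "- v"]
    by (simp add: e_def algebra_simps)
  show ?thesis
  proof (cases "e = 0 \<or> x = y")
    case False
    \<comment> \<open>Among vectors of length |x - y| this one maximises
      \<open>e \<bullet> v\<close>. The left side of \<open>key\<close> is then twice |e| |x - y|,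
      of which Cauchy-Schwarz on the right absorbs only one half.\<close>
    define v where "v = (norm (x - y) / norm e) *\<^sub>R e"
    have nv: "norm v = norm (x - y)" using False by (simp add: v_def)
    have ev: "e \<bullet> v = norm (x - y) * norm e"
      using False by (simp add: v_def dot_square_norm power2_eq_square)
    have "2 * (norm (x - y) * norm e) \<le> c * (norm (x - y))\<^sup>2 + norm e * norm (x - y)"
      using key[of v] norm_cauchy_schwarz[of e "x - y"] unfolding nv ev by linarith
    then have "norm (x - y) * norm e \<le> norm (x - y) * (c * norm (x - y))"
      by (simp add: power2_eq_square mult_ac)
    then show ?thesis using False by (simp add: e_def)
  next
    case True
    \<comment> \<open>With e = 0 and x different from y the claim still needs \<open>c\<close> to be
      nonnegative; squeezing the quadratic form at x - y gives this.\<close>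
    have "0 \<le> c * (norm v)\<^sup>2" for v :: 'a using order_trans[OF lower upper] .
    from this[of "x - y"] have "x \<noteq> y \<Longrightarrow> 0 \<le> c" by (simp add: zero_le_mult_iff)
    with True show ?thesis by (cases "x = y") (auto simp: e_def)
  qed
qed

section \<open>Gaussian shifts\<close>

text \<open>That the total mass is one is not computed from the density: lemmas needing it assume
  \<open>prob_space gauss\<close>, and the theorem supplies it from the law of
  \<open>Z 0\<close>.\<close>

definition gauss :: "'a::euclidean_space measure" where
  "gauss = density lborel (\<lambda>x. ennreal (std_gauss_density x))"

lemma sets_gauss [measurable_cong, simp]: "sets gauss = sets borel"
  and space_gauss [simp]: "space gauss = UNIV"
  by (simp_all add: gauss_def)

lemma borel_measurable_std_gauss_density [measurable]: "std_gauss_density \<in> borel_measurable borel"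
  unfolding std_gauss_density_def[abs_def] by measurable

lemma std_gauss_density_nonneg [simp]: "0 \<le> std_gauss_density x"
  by (simp add: std_gauss_density_def)

lemma std_gauss_density_diff:
  "std_gauss_density (x - b) = std_gauss_density x * exp (b \<bullet> x - (norm b)\<^sup>2 / 2)"
proof -
  have "- (norm (x - b))\<^sup>2 / 2 = - (norm x)\<^sup>2 / 2 + (b \<bullet> x - (norm b)\<^sup>2 / 2)"
    by (simp add: power2_norm_eq_inner inner_diff_left inner_diff_right inner_commute field_simps)
  then show ?thesis unfolding std_gauss_density_def by (simp only: exp_add mult.assoc)
qed

text \<open>Cameron-Martin formula: Lebesgue measure is translation invariant, so only the ratio of
  the shifted to the original density remains.\<close>

lemma distr_gauss_plus:
  "distr gauss borel (\<lambda>z. z + b) = density gauss (\<lambda>z. ennreal (exp (b \<bullet> z - (norm b)\<^sup>2 / 2)))"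
proof -
  \<comment> \<open>Writing the argument as \<open>b + z - b\<close> makes the density a function of
    the image point, the shape that \<open>density_distr\<close> expects.\<close>
  have "distr gauss borel (\<lambda>z. z + b)
      = distr (density lborel (\<lambda>z. ennreal (std_gauss_density (b + z - b)))) borel ((+) b)"
    unfolding gauss_def by (intro arg_cong2[where f = "\<lambda>M f. distr M borel f"]) (auto simp: fun_eq_iff)
  also have "\<dots> = density (distr lborel borel ((+) b)) (\<lambda>z. ennreal (std_gauss_density (z - b)))"
    by (rule density_distr[symmetric]) measurable
  also have "\<dots> = density gauss (\<lambda>z. ennreal (exp (b \<bullet> z - (norm b)\<^sup>2 / 2)))"
    unfolding lborel_distr_plus gauss_def
    by (subst density_density_eq) (auto simp: std_gauss_density_diff ennreal_mult intro!: density_cong)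
  finally show ?thesis .
qed

lemma distr_gauss_uminus: "distr gauss borel uminus = (gauss :: 'a::euclidean_space measure)"
proof -
  have l: "distr lborel borel uminus = (lborel :: 'a measure)"
    using lborel_affine[of "-1" "0::'a"] by (simp add: density_1)
  have "distr gauss borel uminus
      = distr (density lborel (\<lambda>z::'a. ennreal (std_gauss_density (- z)))) borel uminus"
    by (simp add: gauss_def std_gauss_density_def)
  also have "\<dots> = density (distr lborel borel uminus) (\<lambda>z. ennreal (std_gauss_density z))"
    by (rule density_distr[symmetric]) measurable
  finally show ?thesis by (simp add: l gauss_def)
qed

lemma integral_gauss_shift:
  assumes [measurable]: "h \<in> borel_measurable borel"
  shows "(\<integral>z. h (z + b) \<partial>gauss) = (\<integral>z. exp (b \<bullet> z - (norm b)\<^sup>2 / 2) * h z \<partial>gauss)"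
    (is ?I)
    and "integrable gauss (\<lambda>z. h (z + b)) \<longleftrightarrow>
      integrable gauss (\<lambda>z. exp (b \<bullet> z - (norm b)\<^sup>2 / 2) * h z)" (is ?J)
proof -
  have "(\<integral>z. h (z + b) \<partial>gauss) = integral\<^sup>L (distr gauss borel (\<lambda>z. z + b)) h"
    by (simp add: integral_distr)
  then show ?I unfolding distr_gauss_plus by (simp add: integral_density)
  have "integrable gauss (\<lambda>z. h (z + b)) = integrable (distr gauss borel (\<lambda>z. z + b)) h"
    by (simp add: integrable_distr_eq)
  then show ?J unfolding distr_gauss_plus by (simp add: integrable_density)
qed

text \<open>Exponentials of linear forms are integrable because the Cameron-Martin density is, and
  they dominate the linear form itself; the mean vanishes by symmetry under
  \<open>uminus\<close>.\<close>

lemma gauss_inner: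
  fixes b :: "'a::euclidean_space"
  assumes "prob_space (gauss :: 'a measure)"
  shows "integrable gauss (\<lambda>z. b \<bullet> z)" and "(\<integral>z. b \<bullet> z \<partial>gauss) = 0"
proof -
  interpret prob_space "gauss :: 'a measure" by fact
  have e: "integrable gauss (\<lambda>z. exp (b \<bullet> z))" for b :: 'a
  proof -
    have "integrable gauss (\<lambda>z. exp (b \<bullet> z - (norm b)\<^sup>2 / 2))"
      using integral_gauss_shift(2)[of "\<lambda>_. 1" b] by simp
    then have "integrable gauss (\<lambda>z. exp ((norm b)\<^sup>2 / 2) * exp (b \<bullet> z - (norm b)\<^sup>2 / 2))"
      by (rule integrable_mult_right)
    then show ?thesis by (simp add: exp_diff)
  qed
  show i: "integrable gauss (\<lambda>z. b \<bullet> z)"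
  proof (rule Bochner_Integration.integrable_bound)
    show "integrable gauss (\<lambda>z. exp (b \<bullet> z) + exp ((- b) \<bullet> z))"
      by (intro Bochner_Integration.integrable_add e)
    have "\<bar>t\<bar> \<le> exp t + exp (- t)" for t :: real
      using exp_ge_add_one_self[of t] exp_ge_add_one_self[of "- t"] exp_gt_zero[of t] exp_gt_zero[of "- t"]
      by linarith
    then show "AE z in gauss. norm (b \<bullet> z) \<le> norm (exp (b \<bullet> z) + exp ((- b) \<bullet> z))"
      by (intro AE_I2) (simp add: order_trans[OF _ abs_ge_self])
  qed simp
  have "(\<integral>z. b \<bullet> z \<partial>gauss) = (\<integral>z. b \<bullet> z \<partial>distr gauss borel uminus)"
    by (simp only: distr_gauss_uminus)
  also have "\<dots> = - (\<integral>z. b \<bullet> z \<partial>gauss)"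
    by (simp add: integral_distr)
  finally show "(\<integral>z. b \<bullet> z \<partial>gauss) = 0" by simp
qed

text \<open>The bound ranges over the whole type and not only over \<open>space M\<close>, so it
  survives composition with any map and any change of measure.\<close>

definition bounded_measurable :: "'a measure \<Rightarrow> ('a \<Rightarrow> real) \<Rightarrow> bool" where
  "bounded_measurable M \<phi> \<longleftrightarrow> \<phi> \<in> borel_measurable M \<and> (\<exists>c. \<forall>x. \<bar>\<phi> x\<bar> \<le> c)"

lemma bounded_measurableD [measurable_dest]: "bounded_measurable M \<phi> \<Longrightarrow> \<phi> \<in> borel_measurable M"
  by (simp add: bounded_measurable_def)

lemma bounded_measurable_exp:
  assumes "bounded_measurable M \<phi>"
  shows "bounded_measurable M (\<lambda>x. exp (\<phi> x))"
proof -
  from assms obtain c where c: "\<bar>\<phi> x\<bar> \<le> c" for x unfolding bounded_measurable_def by blast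
  have "\<phi> x \<le> c" for x using c[of x] by simp
  then show ?thesis using assms unfolding bounded_measurable_def by (auto intro!: exI[of _ "exp c"])
qed

lemma bounded_measurable_compose:
  "bounded_measurable N \<phi> \<Longrightarrow> g \<in> measurable M N \<Longrightarrow> bounded_measurable M (\<lambda>x. \<phi> (g x))"
  unfolding bounded_measurable_def by (auto intro: measurable_compose)

lemma (in finite_measure) integrable_bounded_measurable:
  "bounded_measurable M \<phi> \<Longrightarrow> integrable M \<phi>"
  unfolding bounded_measurable_def by (metis AE_I2 integrable_const_bound real_norm_def)

lemma (in prob_space) integral_exp_pos:
  assumes "bounded_measurable M \<phi>"
  shows "0 < (\<integral>x. exp (\<phi> x) \<partial>M)"
proof -
  from assms obtain c where c: "\<bar>\<phi> x\<bar> \<le> c" for x unfolding bounded_measurable_def by blast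
  have "exp (- c) = (\<integral>x. exp (- c) \<partial>M)" by (simp add: prob_space)
  also have "\<dots> \<le> (\<integral>x. exp (\<phi> x) \<partial>M)"
    using c by (intro integral_mono integrable_bounded_measurable bounded_measurable_exp assms integrable_const)
      (auto simp: abs_le_iff minus_le_iff)
  finally show ?thesis by (rule less_le_trans[OF exp_gt_zero])
qed

text \<open>Donsker-Varadhan inequality for the Gaussian translated by \<open>b\<close> relative to
  \<open>gauss\<close>; the last term is the relative entropy of the two.\<close>

lemma gauss_log_Harnack:
  fixes b :: "'a::euclidean_space"
  assumes "prob_space (gauss :: 'a measure)" and \<phi>: "bounded_measurable borel \<phi>"
  shows "(\<integral>z. \<phi> (z + b) \<partial>gauss) \<le> ln (\<integral>z. exp (\<phi> z) \<partial>gauss) + (norm b)\<^sup>2 / 2"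
proof -
  interpret prob_space "gauss :: 'a measure" by fact
  have [measurable]: "\<phi> \<in> borel_measurable borel" using \<phi> by (rule bounded_measurableD)
  have bg: "bounded_measurable gauss \<psi> = bounded_measurable borel \<psi>" for \<psi> :: "'a \<Rightarrow> real"
    by (simp add: bounded_measurable_def measurable_cong_sets[OF sets_gauss refl])
  define c where "c = (\<integral>z. exp (\<phi> z) \<partial>gauss)"
  have c: "0 < c" unfolding c_def using \<phi> by (intro integral_exp_pos) (simp add: bg)
  \<comment> \<open>\<open>q z\<close> is the reciprocal of the Cameron-Martin density at
    \<open>z + b\<close>. Weighting by it undoes the shift, so the weighted integral of the shifted
    exponential is again \<open>c\<close>.\<close>
  define q where "q z = exp ((- b) \<bullet> z - (norm b)\<^sup>2 / 2)" for z
  have q_int: "integrable gauss (\<lambda>z. q z * exp (\<phi> (z + b)))"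
    and q_eq: "(\<integral>z. q z * exp (\<phi> (z + b)) \<partial>gauss) = c"
    using integral_gauss_shift[of "\<lambda>z. exp (\<phi> (z + b))" "- b"]
      integrable_bounded_measurable[of "\<lambda>z. exp (\<phi> z)"] \<phi>
    by (simp_all add: q_def c_def bg bounded_measurable_exp)
  \<comment> \<open>This is t + 1 \<le> exp t at t = \<open>\<phi> (z + b)\<close> minus the
    log-density minus \<open>ln c\<close>. On integration the first three terms on the right give
    \<open>ln c\<close>, and the centred linear form drops out.\<close>
  have pw: "\<phi> (z + b) \<le> ln c - 1 + q z * exp (\<phi> (z + b)) / c + (b \<bullet> z + (norm b)\<^sup>2 / 2)" for z
  proof -
    have "q z = exp (- (b \<bullet> z + (norm b)\<^sup>2 / 2))"
      by (simp add: q_def)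
    then have "q z * exp (\<phi> (z + b)) / c = exp (\<phi> (z + b) - (b \<bullet> z + (norm b)\<^sup>2 / 2) - ln c)"
      by (simp only: exp_diff exp_minus exp_ln[OF c] divide_inverse mult_ac)
    then show ?thesis using exp_ge_add_one_self[of "\<phi> (z + b) - (b \<bullet> z + (norm b)\<^sup>2 / 2) - ln c"] by linarith
  qed
  have "(\<integral>z. \<phi> (z + b) \<partial>gauss)
      \<le> (\<integral>z. ln c - 1 + q z * exp (\<phi> (z + b)) / c + (b \<bullet> z + (norm b)\<^sup>2 / 2) \<partial>gauss)"
  proof (rule integral_mono[OF _ _ pw])
    show "integrable gauss (\<lambda>z. \<phi> (z + b))"
      by (intro integrable_bounded_measurable bounded_measurable_compose[OF \<phi>]) measurable
    show "integrable gauss (\<lambda>z. ln c - 1 + q z * exp (\<phi> (z + b)) / c + (b \<bullet> z + (norm b)\<^sup>2 / 2))"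
      by (intro Bochner_Integration.integrable_add integrable_const integrable_divide q_int
          gauss_inner(1)[OF assms(1)])
  qed
  also have "\<dots> = ln c - 1 + (\<integral>z. q z * exp (\<phi> (z + b)) \<partial>gauss) / c + (norm b)\<^sup>2 / 2"
    using q_int gauss_inner[OF assms(1), of b] prob_space by simp
  finally show ?thesis unfolding q_eq using c by (simp add: c_def[symmetric])
qed

section \<open>The log-Harnack inequality for iterated Gaussian kernels\<close>

text \<open>The Markov operator of the transition kernel from u to the normal law with mean
  \<open>G u\<close> and covariance \<sigma>^2 I; its \<open>n\<close>-th power is the
  \<open>n\<close>-step operator.\<close>

definition kernel_op :: "('a::euclidean_space \<Rightarrow> 'a) \<Rightarrow> real \<Rightarrow> ('a \<Rightarrow> real) \<Rightarrow> 'a \<Rightarrow> real" where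
  "kernel_op G \<sigma> \<psi> u = (\<integral>z. \<psi> (G u + \<sigma> *\<^sub>R z) \<partial>gauss)"

text \<open>The first coordinate is a frozen parameter. For the joint law it holds the initial state
  while the operator acts on the current one, and joint measurability later permits setting both
  equal.\<close>

lemma bounded_measurable_kernel_op:
  fixes G :: "'a::euclidean_space \<Rightarrow> 'a" and \<phi> :: "'b \<times> 'a \<Rightarrow> real"
  assumes "prob_space (gauss :: 'a measure)"
    and [measurable]: "G \<in> borel_measurable borel"
    and \<phi>: "bounded_measurable (N \<Otimes>\<^sub>M borel) \<phi>"
  shows "bounded_measurable (N \<Otimes>\<^sub>M borel) (\<lambda>p. kernel_op G \<sigma> (\<lambda>z. \<phi> (fst p, z)) (snd p))"
proof -
  interpret prob_space "gauss :: 'a measure" by fact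
  note [measurable] = bounded_measurableD[OF \<phi>]
  from \<phi> obtain c where c: "\<bar>\<phi> p\<bar> \<le> c" for p unfolding bounded_measurable_def by blast
  have "(\<lambda>p. kernel_op G \<sigma> (\<lambda>z. \<phi> (fst p, z)) (snd p)) \<in> borel_measurable (N \<Otimes>\<^sub>M borel)"
    unfolding kernel_op_def by measurable
  moreover have "\<bar>kernel_op G \<sigma> (\<lambda>z. \<phi> (fst p, z)) (snd p)\<bar> \<le> c" for p
  proof -
    have "\<bar>\<integral>z. \<phi> (fst p, G (snd p) + \<sigma> *\<^sub>R z) \<partial>gauss\<bar> \<le> (\<integral>z. \<bar>\<phi> (fst p, G (snd p) + \<sigma> *\<^sub>R z)\<bar> \<partial>gauss)"
      by (rule integral_abs_bound)
    also have "\<dots> \<le> (\<integral>z. c \<partial>(gauss :: 'a measure))"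
    proof (rule integral_mono')
      show "0 \<le> c" using c[of undefined] abs_ge_zero order_trans by blast
    qed (simp_all add: c)
    finally show ?thesis using prob_space by (simp add: kernel_op_def)
  qed
  ultimately show ?thesis unfolding bounded_measurable_def by blast
qed

lemma bounded_measurable_kernel_op_funpow:
  fixes G :: "'a::euclidean_space \<Rightarrow> 'a" and \<phi> :: "'b \<times> 'a \<Rightarrow> real"
  assumes "prob_space (gauss :: 'a measure)"
    and "G \<in> borel_measurable borel"
    and \<phi>: "bounded_measurable (N \<Otimes>\<^sub>M borel) \<phi>"
  shows "bounded_measurable (N \<Otimes>\<^sub>M borel) (\<lambda>p. (kernel_op G \<sigma> ^^ n) (\<lambda>z. \<phi> (fst p, z)) (snd p))"
proof (induction n)
  case (Suc n)
  from bounded_measurable_kernel_op[OF assms(1,2) this, of \<sigma>] show ?case by simp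
qed (simp add: \<phi>)

lemma bounded_measurable_kernel_op_funpow':
  fixes G :: "'a::euclidean_space \<Rightarrow> 'a"
  assumes "prob_space (gauss :: 'a measure)"
    and "G \<in> borel_measurable borel"
    and \<phi>: "bounded_measurable borel \<phi>"
  shows "bounded_measurable borel ((kernel_op G \<sigma> ^^ n) \<phi>)"
proof -
  have "bounded_measurable (borel \<Otimes>\<^sub>M borel) (\<lambda>p :: 'a \<times> 'a. \<phi> (snd p))"
    by (rule bounded_measurable_compose[OF \<phi>]) simp
  from bounded_measurable_compose[OF bounded_measurable_kernel_op_funpow[OF assms(1,2) this, where \<sigma> = \<sigma> and n = n],
      of "\<lambda>x. (x, x)" borel]
  show ?thesis by simp
qed

text \<open>A positive lower bound keeps the logarithm of the iterate bounded, so that this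
  logarithm can itself serve as a test function.\<close>

lemma kernel_op_funpow_exp_bounded_below:
  fixes G :: "'a::euclidean_space \<Rightarrow> 'a"
  assumes "prob_space (gauss :: 'a measure)" and "G \<in> borel_measurable borel"
    and \<phi>: "bounded_measurable borel \<phi>"
  shows "\<exists>c. \<forall>x. (kernel_op G \<sigma> ^^ n) (\<lambda>z. exp (\<phi> z)) x \<ge> exp c"
proof (induction n)
  case 0
  from \<phi> obtain c where c: "\<And>x. \<bar>\<phi> x\<bar> \<le> c" unfolding bounded_measurable_def by blast
  then have "- c \<le> \<phi> x" for x by (simp add: abs_le_iff minus_le_iff)
  then show ?case by (intro exI[of _ "- c"]) simp
next
  case (Suc n)
  interpret prob_space "gauss :: 'a measure" by fact
  from Suc obtain c where c: "(kernel_op G \<sigma> ^^ n) (\<lambda>z. exp (\<phi> z)) x \<ge> exp c" for x by blast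
  let ?\<psi> = "(kernel_op G \<sigma> ^^ n) (\<lambda>z. exp (\<phi> z))"
  have \<psi>: "bounded_measurable borel ?\<psi>"
    by (intro bounded_measurable_kernel_op_funpow' assms bounded_measurable_exp)
  have "exp c \<le> kernel_op G \<sigma> ?\<psi> x" for x
  proof -
    have "exp c = (\<integral>z. exp c \<partial>(gauss :: 'a measure))" using prob_space by simp
    also have "\<dots> \<le> (\<integral>z. ?\<psi> (G x + \<sigma> *\<^sub>R z) \<partial>gauss)"
      by (intro integral_mono integrable_const integrable_bounded_measurable
          bounded_measurable_compose[OF \<psi>] c) simp
    finally show ?thesis by (simp add: kernel_op_def)
  qed
  then show ?case by auto
qed

lemma kernel_op_log_Harnack_step:
  fixes a b :: "'a::euclidean_space"
  assumes pg: "prob_space (gauss :: 'a measure)" and \<sigma>: "0 < \<sigma>"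
    and \<phi>: "bounded_measurable borel \<phi>"
  shows "(\<integral>z. \<phi> (a + \<sigma> *\<^sub>R z) \<partial>gauss)
      \<le> ln (\<integral>z. exp (\<phi> (b + \<sigma> *\<^sub>R z)) \<partial>gauss) + (norm (a - b))\<^sup>2 / (2 * \<sigma>\<^sup>2)"
proof -
  have "bounded_measurable borel (\<lambda>z. \<phi> (b + \<sigma> *\<^sub>R z))"
    by (rule bounded_measurable_compose[OF \<phi>]) simp
  \<comment> \<open>In units of the noise level, replacing \<open>b\<close> by \<open>a\<close> is a
    shift by (a - b) / \<sigma>.\<close>
  from gauss_log_Harnack[OF pg this, of "(1 / \<sigma>) *\<^sub>R (a - b)"] show ?thesis
    using \<sigma> by (simp add: scaleR_add_right power_divide add.commute)
qed

text \<open>Here \<open>A\<close> prices the Gaussian shift and \<alpha> s / (2 (1 - s)) is the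
  constant for the remaining steps. After \<open>A\<close> is replaced by its upper bound \<alpha> /
  (2 (1 - \<gamma>^2)), the given \<open>l\<close> minimises the quadratic on the left, and the
  minimum times \<gamma>^2 is exactly the right side.\<close>

lemma shift_recursion:
  fixes A \<alpha> \<gamma> s :: real
  assumes A: "A * (1 - \<gamma>\<^sup>2) \<le> \<alpha> / 2" and \<alpha>: "0 \<le> \<alpha>" and \<gamma>: "0 \<le> \<gamma>" "\<gamma> < 1" and s: "0 \<le> s" "s < 1"
  defines "l \<equiv> s * (1 - \<gamma>\<^sup>2) / (1 - \<gamma>\<^sup>2 * s)"
  shows "\<gamma>\<^sup>2 * (A * l\<^sup>2 + \<alpha> / 2 * s / (1 - s) * (1 - l)\<^sup>2) \<le> \<alpha> / 2 * (\<gamma>\<^sup>2 * s) / (1 - \<gamma>\<^sup>2 * s)"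
proof -
  have g2: "\<gamma>\<^sup>2 < 1" using \<gamma> by (simp add: power_less_one_iff)
  define q where "q = 1 - \<gamma>\<^sup>2 * s"
  have q: "0 < q" using g2 s mult_right_mono[of "\<gamma>\<^sup>2" 1 s] unfolding q_def by simp
  have l1: "1 - l = (1 - s) / q" using q unfolding l_def q_def[symmetric]
    by (simp add: field_simps) (simp add: q_def algebra_simps)
  have "A * l\<^sup>2 = (A * (1 - \<gamma>\<^sup>2)) * (s\<^sup>2 * (1 - \<gamma>\<^sup>2) / q\<^sup>2)"
    unfolding l_def q_def[symmetric] by (simp add: power2_eq_square)
  also have "\<dots> \<le> \<alpha> / 2 * (s\<^sup>2 * (1 - \<gamma>\<^sup>2) / q\<^sup>2)"
    using A g2 by (intro mult_right_mono) auto
  finally have "A * l\<^sup>2 + \<alpha> / 2 * s / (1 - s) * (1 - l)\<^sup>2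
      \<le> \<alpha> / 2 * (s\<^sup>2 * (1 - \<gamma>\<^sup>2) / q\<^sup>2) + \<alpha> / 2 * s / (1 - s) * ((1 - s) / q)\<^sup>2"
    unfolding l1 by simp
  also have "\<dots> = \<alpha> / 2 * ((s\<^sup>2 * (1 - \<gamma>\<^sup>2) + s * (1 - s)) / q\<^sup>2)"
    using s q by (simp add: power2_eq_square field_simps)
  also have "s\<^sup>2 * (1 - \<gamma>\<^sup>2) + s * (1 - s) = s * q"
    by (simp add: q_def power2_eq_square algebra_simps)
  also have "s * q / q\<^sup>2 = s / q" using q by (simp add: power2_eq_square)
  finally have "\<gamma>\<^sup>2 * (A * l\<^sup>2 + \<alpha> / 2 * s / (1 - s) * (1 - l)\<^sup>2) \<le> \<gamma>\<^sup>2 * (\<alpha> / 2 * (s / q))"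
    by (rule mult_left_mono) simp
  then show ?thesis by (simp add: q_def mult_ac)
qed


text \<open>The synchronous coupling started at \<open>x\<close> and \<open>y\<close> is shifted by the fraction \<open>l\<close> of the
  distance at the first step, at the price of one Gaussian shift, and the remaining fraction
  \<open>1 - l\<close> is left to the remaining steps.\<close>

lemma kernel_op_log_Harnack:
  fixes G :: "'a::euclidean_space \<Rightarrow> 'a"
  assumes pg: "prob_space (gauss :: 'a measure)" and Gm: "G \<in> borel_measurable borel"
    and lip: "\<And>x y. norm (G x - G y) \<le> \<gamma> * norm (x - y)" and \<gamma>: "0 \<le> \<gamma>" "\<gamma> < 1"
    and \<sigma>: "0 < \<sigma>" and \<alpha>: "1 / (2 * \<sigma>\<^sup>2) * (1 - \<gamma>\<^sup>2) \<le> \<alpha> / 2" "0 \<le> \<alpha>"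
    and n: "1 \<le> n" and \<phi>: "bounded_measurable borel \<phi>"
  shows "(kernel_op G \<sigma> ^^ n) \<phi> x \<le> ln ((kernel_op G \<sigma> ^^ n) (\<lambda>z. exp (\<phi> z)) y)
     + \<alpha> / 2 * \<gamma> ^ (2 * n) / (1 - \<gamma> ^ (2 * n)) * (norm (x - y))\<^sup>2"
  using n
proof (induction n arbitrary: x y rule: nat_induct_at_least)
  case base
  have g: "\<gamma>\<^sup>2 < 1" using \<gamma> by (simp add: power_less_one_iff)
  \<comment> \<open>In the last step nothing is left to contraction: the Gaussian shift removes the
    whole difference of \<open>G x\<close> and \<open>G y\<close>.\<close>
  have "(norm (G x - G y))\<^sup>2 / (2 * \<sigma>\<^sup>2) \<le> 1 / (2 * \<sigma>\<^sup>2) * (\<gamma> * norm (x - y))\<^sup>2"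
    using power_mono[OF lip[of x y], of 2] \<sigma> by (simp add: divide_right_mono)
  also have "\<dots> = 1 / (2 * \<sigma>\<^sup>2) * (1 - \<gamma>\<^sup>2) * (\<gamma>\<^sup>2 / (1 - \<gamma>\<^sup>2) * (norm (x - y))\<^sup>2)"
    using g by (simp add: power_mult_distrib)
  also have "\<dots> \<le> \<alpha> / 2 * (\<gamma>\<^sup>2 / (1 - \<gamma>\<^sup>2) * (norm (x - y))\<^sup>2)"
    using g by (intro mult_right_mono \<alpha>) auto
  finally show ?case
    using kernel_op_log_Harnack_step[OF pg \<sigma> \<phi>, of "G x" "G y"] by (simp add: kernel_op_def)
next
  case (Suc n)
  interpret prob_space "gauss :: 'a measure" by (fact pg)
  define \<psi> \<xi> where "\<psi> = (kernel_op G \<sigma> ^^ n) \<phi>" and "\<xi> = (kernel_op G \<sigma> ^^ n) (\<lambda>z. exp (\<phi> z))"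
  have bm: "bounded_measurable borel \<psi>" "bounded_measurable borel \<xi>"
    unfolding \<psi>_def \<xi>_def by (intro bounded_measurable_kernel_op_funpow' pg Gm bounded_measurable_exp \<phi>)+
  obtain c where c: "exp c \<le> \<xi> u" for u
    using kernel_op_funpow_exp_bounded_below[OF pg Gm \<phi>, where \<sigma> = \<sigma> and n = n] unfolding \<xi>_def by blast
  then have pos: "0 < \<xi> u" for u using less_le_trans[OF exp_gt_zero] by blast
  obtain d where d: "\<bar>\<xi> u\<bar> \<le> d" for u using bm unfolding bounded_measurable_def by blast
  \<comment> \<open>The shift inequality is applied to \<open>ln \<xi>\<close>, whose exponential is
    \<open>\<xi>\<close>; this is how the logarithm passes outside one more averaging.\<close>
  have ln_bm: "bounded_measurable borel (\<lambda>u. ln (\<xi> u))"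
    unfolding bounded_measurable_def
  proof safe
    show "(\<lambda>u. ln (\<xi> u)) \<in> borel_measurable borel"
      using bounded_measurableD[OF bm(2)] by measurable
    have "\<bar>ln (\<xi> u)\<bar> \<le> max \<bar>c\<bar> \<bar>ln d\<bar>" for u
    proof -
      have "c \<le> ln (\<xi> u)" using c[of u] pos by (simp add: ln_ge_iff)
      moreover have "ln (\<xi> u) \<le> ln d" using d[of u] pos[of u] by (intro ln_mono) auto
      ultimately show ?thesis by linarith
    qed
    then show "\<exists>c. \<forall>u. \<bar>ln (\<xi> u)\<bar> \<le> c" by blast
  qed
  define s where "s = \<gamma> ^ (2 * n)"
  have s: "0 \<le> s" "s < 1"
    using \<gamma> Suc.hyps by (auto simp: s_def power_less_one_iff)
  define l where "l = s * (1 - \<gamma>\<^sup>2) / (1 - \<gamma>\<^sup>2 * s)"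
  define C where "C = \<alpha> / 2 * s / (1 - s)"
  define w where "w = G y + l *\<^sub>R (G x - G y)"
  have w: "G x - w = (1 - l) *\<^sub>R (G x - G y)" "w - G y = l *\<^sub>R (G x - G y)"
    by (simp_all add: w_def algebra_simps)
  have b1: "bounded_measurable borel h \<Longrightarrow> integrable gauss (\<lambda>z. h (v + \<sigma> *\<^sub>R z))" for h and v :: 'a
    by (rule integrable_bounded_measurable, erule bounded_measurable_compose) simp
  \<comment> \<open>The induction hypothesis compares two points driven by the same noise
    \<open>z\<close>, centred at \<open>G x\<close> and at the intermediate point \<open>w\<close>.
    The passage from \<open>w\<close> to \<open>G y\<close> is then paid for by the shift.\<close>
  have "kernel_op G \<sigma> \<psi> x \<le> (\<integral>z. ln (\<xi> (w + \<sigma> *\<^sub>R z)) + C * (norm (G x - w))\<^sup>2 \<partial>gauss)"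
    unfolding kernel_op_def
  proof (rule integral_mono)
    fix z
    show "\<psi> (G x + \<sigma> *\<^sub>R z) \<le> ln (\<xi> (w + \<sigma> *\<^sub>R z)) + C * (norm (G x - w))\<^sup>2"
      using Suc.IH[of "G x + \<sigma> *\<^sub>R z" "w + \<sigma> *\<^sub>R z"] by (simp add: \<psi>_def \<xi>_def C_def s_def)
  qed (intro Bochner_Integration.integrable_add integrable_const b1 bm ln_bm)+
  also have "\<dots> = (\<integral>z. ln (\<xi> (w + \<sigma> *\<^sub>R z)) \<partial>gauss) + C * (norm (G x - w))\<^sup>2"
    using b1[OF ln_bm, of w] prob_space by simp
  also have "(\<integral>z. ln (\<xi> (w + \<sigma> *\<^sub>R z)) \<partial>gauss)
      \<le> ln (kernel_op G \<sigma> \<xi> y) + (norm (w - G y))\<^sup>2 / (2 * \<sigma>\<^sup>2)"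
    using kernel_op_log_Harnack_step[OF pg \<sigma> ln_bm, of w "G y"] pos by (simp add: kernel_op_def)
  finally have "kernel_op G \<sigma> \<psi> x \<le> ln (kernel_op G \<sigma> \<xi> y)
      + (1 / (2 * \<sigma>\<^sup>2) * l\<^sup>2 + C * (1 - l)\<^sup>2) * (norm (G x - G y))\<^sup>2"
    unfolding w norm_scaleR power_mult_distrib power2_abs by (simp add: algebra_simps)
  also have "(1 / (2 * \<sigma>\<^sup>2) * l\<^sup>2 + C * (1 - l)\<^sup>2) * (norm (G x - G y))\<^sup>2
      \<le> (1 / (2 * \<sigma>\<^sup>2) * l\<^sup>2 + C * (1 - l)\<^sup>2) * (\<gamma> * norm (x - y))\<^sup>2"
    using lip[of x y] \<alpha>(2) s by (intro mult_left_mono power_mono) (auto simp: C_def)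
  also have "\<dots> = \<gamma>\<^sup>2 * (1 / (2 * \<sigma>\<^sup>2) * l\<^sup>2 + C * (1 - l)\<^sup>2) * (norm (x - y))\<^sup>2"
    by (simp add: power_mult_distrib)
  also have "\<dots> \<le> \<alpha> / 2 * (\<gamma>\<^sup>2 * s) / (1 - \<gamma>\<^sup>2 * s) * (norm (x - y))\<^sup>2"
    unfolding C_def l_def by (intro mult_right_mono shift_recursion \<alpha> \<gamma> s) simp
  finally show ?case by (simp add: \<psi>_def \<xi>_def s_def power2_eq_square mult.assoc)
qed

section \<open>A variational bound on relative entropy\<close>

lemma tendsto_clamp: "(\<lambda>n. max (- real n) (min x (real n))) \<longlonglongrightarrow> x"
proof (rule tendsto_eventually)
  have "eventually (\<lambda>n. \<bar>x\<bar> \<le> real n) sequentially"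
    by (meson eventually_sequentiallyI le_nat_iff nat_ceiling_le_eq real_nat_ceiling_ge order_trans of_nat_mono)
  then show "eventually (\<lambda>n. max (- real n) (min x (real n)) = x) sequentially"
    by eventually_elim auto
qed

text \<open>Converse to the Donsker--Varadhan inequality. Absolute continuity follows from the test
  functions \<open>n 1\<^sub>A\<close> with \<open>A\<close> a null set, and the entropy bound from truncations of the
  log-density.\<close>

lemma KL_le_if_Donsker_Varadhan:
  fixes \<mu> \<nu> :: "'a measure"
  assumes "prob_space \<mu>" "prob_space \<nu>" and sets_eq: "sets \<mu> = sets \<nu>"
    and DV: "\<And>\<phi>. bounded_measurable \<nu> \<phi> \<Longrightarrow> (\<integral>x. \<phi> x \<partial>\<mu>) \<le> (\<integral>x. exp (\<phi> x) \<partial>\<nu>) - 1 + B"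
  shows "KL \<mu> \<nu> \<le> ereal B"
proof -
  interpret \<mu>: prob_space \<mu> by fact
  interpret \<nu>: prob_space \<nu> by fact
  note [measurable_cong] = sets_eq
  have bm_iff: "bounded_measurable \<mu> \<phi> = bounded_measurable \<nu> \<phi>" for \<phi>
    by (simp add: bounded_measurable_def measurable_cong_sets[OF sets_eq refl])
  have ac: "absolutely_continuous \<nu> \<mu>"
    unfolding absolutely_continuous_def
  proof
    fix A assume A: "A \<in> null_sets \<nu>"
    then have [measurable]: "A \<in> sets \<nu>" "A \<in> sets \<mu>" using sets_eq by auto
    have "measure \<mu> A \<le> B / real n" if "1 \<le> n" for n :: nat
    proof -
      have "(\<integral>x. real n * indicator A x \<partial>\<mu>) \<le> (\<integral>x. exp (real n * indicator A x) \<partial>\<nu>) - 1 + B"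
      proof (rule DV)
        show "bounded_measurable \<nu> (\<lambda>x. real n * indicator A x)"
          unfolding bounded_measurable_def
          by (auto intro!: exI[of _ "real n"] simp: indicator_def)
      qed
      also have "(\<integral>x. exp (real n * indicator A x) \<partial>\<nu>) = (\<integral>x. 1 \<partial>\<nu>)"
      proof (rule integral_cong_AE)
        show "AE x in \<nu>. exp (real n * indicator A x) = (1 :: real)"
          using AE_not_in[OF A] by eventually_elim simp
      qed simp_all
      finally show ?thesis using that by (simp add: \<nu>.prob_space field_simps)
    qed
    moreover have "(\<lambda>n. B / real n) \<longlonglongrightarrow> 0" by real_asymp
    ultimately have "measure \<mu> A \<le> 0"
      by (intro LIMSEQ_le_const) auto
    then show "A \<in> null_sets \<mu>" by (auto simp: null_sets_def \<mu>.emeasure_eq_measure measure_le_0_iff)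
  qed
  define r where "r x = enn2real (RN_deriv \<nu> \<mu> x)" for x
  have [measurable]: "r \<in> borel_measurable \<nu>" unfolding r_def by measurable
  have r0: "0 \<le> r x" for x by (simp add: r_def)
  have sf: "sigma_finite_measure \<mu>" by unfold_locales
  have r_int: "integrable \<nu> r" and r1: "(\<integral>x. r x \<partial>\<nu>) = 1"
    using \<nu>.RN_deriv_integrable[OF sf ac sets_eq, of "\<lambda>_. 1"]
      \<nu>.RN_deriv_integral[OF sf ac sets_eq, of "\<lambda>_. 1"] \<mu>.prob_space
    by (simp_all add: r_def[abs_def])
  have r_pos: "AE x in \<mu>. 0 < r x"
  proof -
    have r_density: "\<mu> = density \<nu> (\<lambda>x. ennreal (r x))"
    proof -
      have "density \<nu> (\<lambda>x. ennreal (r x)) = density \<nu> (RN_deriv \<nu> \<mu>)"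
        using \<nu>.RN_deriv_finite[OF sf ac sets_eq]
        by (intro density_cong) (auto simp: r_def less_top)
      then show ?thesis by (simp add: \<nu>.density_RN_deriv[OF ac sets_eq])
    qed
    have "AE x in density \<nu> (\<lambda>x. ennreal (r x)). 0 < r x"
      by (subst AE_density) simp_all
    then show ?thesis by (subst r_density)
  qed
  \<comment> \<open>Since \<open>ln 0\<close> is 0, clamping alone would give the value 0 where
    \<open>r\<close> vanishes; the value -n, the clamp of minus infinity, keeps the exponential
    small there.\<close>
  define \<phi> where "\<phi> n x = (if r x = 0 then - real n else max (- real n) (min (ln (r x)) (real n)))" for n :: nat and x
  have \<phi>_bm: "bounded_measurable \<nu> (\<phi> n)" for n
    unfolding bounded_measurable_def
  proof
    show "\<phi> n \<in> borel_measurable \<nu>" unfolding \<phi>_def by measurable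
    show "\<exists>c. \<forall>x. \<bar>\<phi> n x\<bar> \<le> c" by (intro exI[of _ "real n"]) (auto simp: \<phi>_def)
  qed
  \<comment> \<open>The positive part yields only the bound 1 + B. This suffices for integrability
    by Fatou; the sharp bound B comes afterwards from \<open>\<phi>\<close>.\<close>
  define \<phi>p where "\<phi>p n x = max 0 (\<phi> n x)" for n :: nat and x
  have \<phi>p_bm: "bounded_measurable \<nu> (\<phi>p n)" for n
    unfolding bounded_measurable_def
  proof
    show "\<phi>p n \<in> borel_measurable \<nu>" unfolding \<phi>_def \<phi>p_def by measurable
    show "\<exists>c. \<forall>x. \<bar>\<phi>p n x\<bar> \<le> c" by (intro exI[of _ "real n"]) (auto simp: \<phi>_def \<phi>p_def)
  qed
  \<comment> \<open>Clamping from above only lowers the exponential; clamping from below raises it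
    to at most \<open>exp (- real n)\<close>, an error that vanishes in the limit.\<close>
  have exp_\<phi>: "exp (\<phi> n x) \<le> r x + exp (- real n)" for n x
  proof (cases "r x = 0")
    case False
    then have r: "0 < r x" using r0[of x] by simp
    have "\<phi> n x \<le> ln (r x) \<or> \<phi> n x = - real n" using False by (auto simp: \<phi>_def)
    then show ?thesis
    proof
      assume "\<phi> n x \<le> ln (r x)"
      then have "exp (\<phi> n x) \<le> r x" using r by (simp add: ln_ge_iff)
      then show ?thesis by (simp add: add_increasing2)
    qed (simp add: r0)
  qed (simp add: \<phi>_def)
  have \<phi>_int: "(\<integral>x. \<phi> n x \<partial>\<mu>) \<le> exp (- real n) + B" for n
  proof -
    have "(\<integral>x. exp (\<phi> n x) \<partial>\<nu>) \<le> (\<integral>x. r x + exp (- real n) \<partial>\<nu>)"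
      by (intro integral_mono exp_\<phi> \<nu>.integrable_bounded_measurable[OF bounded_measurable_exp[OF \<phi>_bm]])
        (simp add: r_int)
    also have "\<dots> = 1 + exp (- real n)" using r_int by (simp add: r1 \<nu>.prob_space)
    finally show ?thesis using DV[OF \<phi>_bm, of n] by simp
  qed
  have \<phi>p_int: "(\<integral>x. \<phi>p n x \<partial>\<mu>) \<le> 1 + B" for n
  proof -
    have "exp (\<phi>p n x) \<le> r x + 1" for x
      using exp_\<phi>[of n x] r0[of x] order_trans[OF exp_\<phi>[of n x], of "r x + 1"]
      by (auto simp: \<phi>p_def max_def)
    then have "(\<integral>x. exp (\<phi>p n x) \<partial>\<nu>) \<le> (\<integral>x. r x + 1 \<partial>\<nu>)"
      by (intro integral_mono \<nu>.integrable_bounded_measurable[OF bounded_measurable_exp[OF \<phi>p_bm]])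
        (simp_all add: r_int)
    also have "\<dots> = 2" using r_int by (simp add: r1 \<nu>.prob_space)
    finally show ?thesis using DV[OF \<phi>p_bm, of n] by simp
  qed
  have pos_fin: "(\<integral>\<^sup>+x. ennreal (max 0 (ln (r x))) \<partial>\<mu>) \<le> ennreal (1 + B)"
  proof -
    have lim: "AE x in \<mu>. ennreal (max 0 (ln (r x))) = liminf (\<lambda>n. ennreal (\<phi>p n x))"
      using r_pos
    proof eventually_elim
      case (elim x)
      have "(\<lambda>n. ennreal (\<phi>p n x)) \<longlonglongrightarrow> ennreal (max 0 (ln (r x)))"
        using elim unfolding \<phi>p_def \<phi>_def
        by (intro tendsto_ennrealI tendsto_max tendsto_const) (use tendsto_clamp in simp)
      then show ?case by (simp add: lim_imp_Liminf)
    qed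
    have [measurable]: "\<phi>p n \<in> borel_measurable \<nu>" for n by (rule bounded_measurableD[OF \<phi>p_bm])
    have "(\<integral>\<^sup>+x. ennreal (max 0 (ln (r x))) \<partial>\<mu>) = (\<integral>\<^sup>+x. liminf (\<lambda>n. ennreal (\<phi>p n x)) \<partial>\<mu>)"
      by (rule nn_integral_cong_AE[OF lim])
    also have "\<dots> \<le> liminf (\<lambda>n. \<integral>\<^sup>+x. ennreal (\<phi>p n x) \<partial>\<mu>)"
      by (rule nn_integral_liminf) simp
    also have "\<dots> \<le> limsup (\<lambda>n. \<integral>\<^sup>+x. ennreal (\<phi>p n x) \<partial>\<mu>)"
      by (rule Liminf_le_Limsup) simp
    also have "\<dots> \<le> ennreal (1 + B)"
    proof (rule Limsup_bounded, rule always_eventually, rule allI)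
      fix n
      have "(\<integral>\<^sup>+x. ennreal (\<phi>p n x) \<partial>\<mu>) = ennreal (\<integral>x. \<phi>p n x \<partial>\<mu>)"
        by (rule nn_integral_eq_integral, rule \<mu>.integrable_bounded_measurable)
          (simp only: bm_iff \<phi>p_bm, simp add: \<phi>p_def)
      then show "(\<integral>\<^sup>+x. ennreal (\<phi>p n x) \<partial>\<mu>) \<le> ennreal (1 + B)"
        using \<phi>p_int[of n] by (simp add: ennreal_leI)
    qed
    finally show ?thesis .
  qed
  have i_pos: "integrable \<mu> (\<lambda>x. max 0 (ln (r x)))"
    by (rule integrableI_bounded) (use pos_fin in \<open>auto intro: le_less_trans\<close>)
  \<comment> \<open>The negative part is integrable because \<open>- r ln r \<le> 1 - r\<close>.\<close>
  have i_neg: "integrable \<mu> (\<lambda>x. max 0 (- ln (r x)))"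
  proof (subst \<nu>.RN_deriv_integrable[OF sf ac sets_eq])
    have "norm (r x * max 0 (- ln (r x))) \<le> 1" for x
    proof (cases "r x = 0")
      case False
      then have r: "0 < r x" using r0[of x] by simp
      have "- ln (r x) \<le> 1 / r x - 1"
        using ln_le_minus_one[of "1 / r x"] r by (simp add: ln_div)
      then have "r x * max 0 (- ln (r x)) \<le> r x * (1 / r x)"
        using r by (intro mult_left_mono) auto
      then show ?thesis using r by simp
    qed simp
    then show "integrable \<nu> (\<lambda>x. enn2real (RN_deriv \<nu> \<mu> x) * max 0 (- ln (r x)))"
      unfolding r_def[symmetric] by (intro \<nu>.integrable_const_bound[where B = 1]) auto
  qed simp
  have i_ln: "integrable \<mu> (\<lambda>x. ln (r x))"
  proof -
    have "(\<lambda>x. ln (r x)) = (\<lambda>x. max 0 (ln (r x)) - max 0 (- ln (r x)))" by (auto simp: max_def)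
    then show ?thesis using i_pos i_neg by (simp only: Bochner_Integration.integrable_diff)
  qed
  have [measurable]: "\<phi> n \<in> borel_measurable \<mu>" for n
    using bounded_measurableD[OF \<phi>_bm] measurable_cong_sets[OF sets_eq refl] by blast
  \<comment> \<open>Clamping to [-n, n] does not increase absolute values, so |ln r|, now known to
    be integrable, dominates.\<close>
  have "(\<lambda>n. \<integral>x. \<phi> n x \<partial>\<mu>) \<longlonglongrightarrow> (\<integral>x. ln (r x) \<partial>\<mu>)"
  proof (rule integral_dominated_convergence[where w = "\<lambda>x. \<bar>ln (r x)\<bar>"])
    show "AE x in \<mu>. (\<lambda>n. \<phi> n x) \<longlonglongrightarrow> ln (r x)"
      using r_pos by eventually_elim (use tendsto_clamp in \<open>simp add: \<phi>_def\<close>)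
    show "AE x in \<mu>. norm (\<phi> n x) \<le> \<bar>ln (r x)\<bar>" for n
      using r_pos by eventually_elim (auto simp: \<phi>_def)
  qed (use i_ln in auto)
  moreover have "(\<lambda>n. exp (- real n) + B) \<longlonglongrightarrow> B" by real_asymp
  ultimately have "(\<integral>x. ln (r x) \<partial>\<mu>) \<le> B"
    by (rule LIMSEQ_le) (use \<phi>_int in auto)
  then show ?thesis using ac sets_eq i_ln unfolding KL_def r_def by simp
qed

section \<open>The joint law of the initial and current states\<close>

text \<open>Unrolled, the recursion makes the pair a measurable function of the initial state and of
  the noises before time \<open>n\<close>, a block of inputs disjoint from \<open>Z n\<close>;
  independence of the blocks gives the product law.\<close>

lemma (in prob_space) distr_pair_noise:
  fixes X :: "nat \<Rightarrow> 'a \<Rightarrow> 'b::euclidean_space" and Z :: "nat \<Rightarrow> 'a \<Rightarrow> 'b"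
  assumes [measurable]: "G \<in> borel_measurable borel"
    and indep: "indep_vars (\<lambda>_. borel) (\<lambda>i. case i of None \<Rightarrow> X 0 | Some j \<Rightarrow> Z j) UNIV"
    and step: "\<And>j \<omega>. X (Suc j) \<omega> = G (X j \<omega>) + \<sigma> *\<^sub>R Z j \<omega>"
  shows "(\<lambda>\<omega>. (X 0 \<omega>, X n \<omega>)) \<in> M \<rightarrow>\<^sub>M borel \<Otimes>\<^sub>M borel" and "Z n \<in> M \<rightarrow>\<^sub>M borel"
    and "distr M ((borel \<Otimes>\<^sub>M borel) \<Otimes>\<^sub>M borel) (\<lambda>\<omega>. ((X 0 \<omega>, X n \<omega>), Z n \<omega>))
      = distr M (borel \<Otimes>\<^sub>M borel) (\<lambda>\<omega>. (X 0 \<omega>, X n \<omega>)) \<Otimes>\<^sub>M distr M borel (Z n)"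
proof -
  define W where "W = (\<lambda>i. case i of None \<Rightarrow> X 0 | Some j \<Rightarrow> Z j)"
  \<comment> \<open>The recursion replayed on an arbitrary configuration of inputs, with
    \<open>None\<close> as the initial state and \<open>Some j\<close> as the noise at time
    \<open>j\<close>.\<close>
  define F where "F w = rec_nat (w None) (\<lambda>j u. G u + \<sigma> *\<^sub>R w (Some j))" for w :: "nat option \<Rightarrow> 'b"
  \<comment> \<open>The inequality is strict because \<open>Z n\<close> first enters at
    \<open>X (Suc n)\<close>.\<close>
  define I where "I = insert None (Some ` {..<n})"
  have F: "F (\<lambda>i\<in>I. W i \<omega>) j = X j \<omega>" if "j \<le> n" for j \<omega>
    using that
  proof (induction j)
    case 0
    show ?case by (simp add: F_def W_def I_def)
  next
    case (Suc j)
    then show ?case by (auto simp: F_def W_def I_def step)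
  qed
  have meas: "(\<lambda>w. F w j) \<in> borel_measurable (PiM I (\<lambda>_. borel))" if "j \<le> n" for j
    using that
  proof (induction j)
    case 0
    have "None \<in> I" by (simp add: I_def)
    then show ?case by (simp add: F_def)
  next
    case (Suc j)
    then have "Some j \<in> I" by (simp add: I_def)
    then have [measurable]: "(\<lambda>w. w (Some j)) \<in> borel_measurable (PiM I (\<lambda>_. borel :: 'b measure))"
      by simp
    have [measurable]: "(\<lambda>w. F w j) \<in> borel_measurable (PiM I (\<lambda>_. borel))" using Suc by simp
    have "(\<lambda>w. G (F w j) + \<sigma> *\<^sub>R w (Some j)) \<in> borel_measurable (PiM I (\<lambda>_. borel))" by measurable
    then show ?case by (simp add: F_def)
  qed
  let ?A = "PiM I (\<lambda>_. borel :: 'b measure)" and ?B = "PiM {Some n} (\<lambda>_. borel :: 'b measure)"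
  let ?U = "\<lambda>\<omega>. \<lambda>i\<in>I. W i \<omega>" and ?V = "\<lambda>\<omega>. \<lambda>i\<in>{Some n}. W i \<omega>"
  let ?f = "\<lambda>w. (F w 0, F w n)" and ?g = "\<lambda>w. w (Some n)"
  have iv: "indep_var ?A ?U ?B ?V"
    by (rule indep_var_restrict[OF indep[folded W_def]]) (auto simp: I_def)
  note [measurable] = indep_var_rv1[OF iv] indep_var_rv2[OF iv]
  have f [measurable]: "?f \<in> ?A \<rightarrow>\<^sub>M borel \<Otimes>\<^sub>M borel"
    by (intro measurable_Pair meas) auto
  have g [measurable]: "?g \<in> ?B \<rightarrow>\<^sub>M borel"
    by simp
  have fU: "?f (?U \<omega>) = (X 0 \<omega>, X n \<omega>)" and gV: "?g (?V \<omega>) = Z n \<omega>" for \<omega>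
    using F[of 0] F[of n] by (simp_all add: W_def)
  have "(\<lambda>\<omega>. ?f (?U \<omega>)) \<in> M \<rightarrow>\<^sub>M borel \<Otimes>\<^sub>M borel"
    by (rule measurable_compose[OF indep_var_rv1[OF iv] f])
  then show "(\<lambda>\<omega>. (X 0 \<omega>, X n \<omega>)) \<in> M \<rightarrow>\<^sub>M borel \<Otimes>\<^sub>M borel"
    unfolding fU .
  have gV_meas: "(\<lambda>\<omega>. ?g (?V \<omega>)) \<in> M \<rightarrow>\<^sub>M borel"
    by (rule measurable_compose[OF indep_var_rv2[OF iv] g])
  then show "Z n \<in> M \<rightarrow>\<^sub>M borel"
    unfolding gV .
  have "distr M (borel \<Otimes>\<^sub>M borel) (\<lambda>\<omega>. ?f (?U \<omega>)) \<Otimes>\<^sub>M distr M borel (\<lambda>\<omega>. ?g (?V \<omega>))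
      = distr (distr M ?A ?U) (borel \<Otimes>\<^sub>M borel) ?f \<Otimes>\<^sub>M distr (distr M ?B ?V) borel ?g"
    using f g indep_var_rv1[OF iv] indep_var_rv2[OF iv] by (simp only: distr_distr comp_def)
  also have "\<dots> = distr (distr M ?A ?U \<Otimes>\<^sub>M distr M ?B ?V) ((borel \<Otimes>\<^sub>M borel) \<Otimes>\<^sub>M borel)
      (\<lambda>(x, y). (?f x, ?g y))"
  proof (rule pair_measure_distr)
    have "prob_space (distr M borel (\<lambda>\<omega>. ?g (?V \<omega>)))"
      by (rule prob_space_distr[OF gV_meas])
    then show "sigma_finite_measure (distr (distr M ?B ?V) borel ?g)"
      using g indep_var_rv2[OF iv]
      by (simp only: distr_distr comp_def) (simp add: prob_space_imp_sigma_finite)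
  qed (use f g in \<open>simp_all only: measurable_distr_eq1\<close>)
  also have "distr M ?A ?U \<Otimes>\<^sub>M distr M ?B ?V = distr M (?A \<Otimes>\<^sub>M ?B) (\<lambda>\<omega>. (?U \<omega>, ?V \<omega>))"
    using iv unfolding indep_var_distribution_eq by blast
  also have "distr \<dots> ((borel \<Otimes>\<^sub>M borel) \<Otimes>\<^sub>M borel) (\<lambda>(x, y). (?f x, ?g y))
      = distr M ((borel \<Otimes>\<^sub>M borel) \<Otimes>\<^sub>M borel) (\<lambda>\<omega>. (?f (?U \<omega>), ?g (?V \<omega>)))"
    by (subst distr_distr) (simp_all add: comp_def)
  finally show "distr M ((borel \<Otimes>\<^sub>M borel) \<Otimes>\<^sub>M borel) (\<lambda>\<omega>. ((X 0 \<omega>, X n \<omega>), Z n \<omega>))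
      = distr M (borel \<Otimes>\<^sub>M borel) (\<lambda>\<omega>. (X 0 \<omega>, X n \<omega>)) \<Otimes>\<^sub>M distr M borel (Z n)"
    unfolding fU gV by (rule sym)
qed

text \<open>Markov property: integrating out the last noise replaces the test function by its
  one-step average in the second coordinate. The induction therefore generalises over
  \<open>\<phi>\<close>.\<close>

lemma (in prob_space) expectation_kernel_op_funpow:
  fixes X :: "nat \<Rightarrow> 'a \<Rightarrow> 'b::euclidean_space" and Z :: "nat \<Rightarrow> 'a \<Rightarrow> 'b"
  assumes pg: "prob_space (gauss :: 'b measure)" and G: "G \<in> borel_measurable borel"
    and indep: "indep_vars (\<lambda>_. borel) (\<lambda>i. case i of None \<Rightarrow> X 0 | Some j \<Rightarrow> Z j) UNIV"
    and step: "\<And>j \<omega>. X (Suc j) \<omega> = G (X j \<omega>) + \<sigma> *\<^sub>R Z j \<omega>"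
    and Z: "\<And>j. distr M borel (Z j) = gauss"
    and \<phi>: "bounded_measurable (borel \<Otimes>\<^sub>M borel) \<phi>"
  shows "expectation (\<lambda>\<omega>. \<phi> (X 0 \<omega>, X n \<omega>))
    = expectation (\<lambda>\<omega>. (kernel_op G \<sigma> ^^ n) (\<lambda>z. \<phi> (X 0 \<omega>, z)) (X 0 \<omega>))"
  using \<phi>
proof (induction n arbitrary: \<phi>)
  case (Suc n)
  interpret N: prob_space "gauss :: 'b measure" by (fact pg)
  note [measurable] = G bounded_measurableD[OF Suc.prems]
  note pair = distr_pair_noise[where X = X and Z = Z and n = n, OF G indep step]
  note [measurable] = pair(1,2)
  define D where "D = distr M (borel \<Otimes>\<^sub>M borel) (\<lambda>\<omega>. (X 0 \<omega>, X n \<omega>))"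
  interpret D: prob_space D unfolding D_def by (rule prob_space_distr) simp
  interpret DN: pair_prob_space D "gauss :: 'b measure" ..
  have [measurable_cong]: "sets D = sets (borel \<Otimes>\<^sub>M borel)" by (simp add: D_def)
  have joint: "distr M ((borel \<Otimes>\<^sub>M borel) \<Otimes>\<^sub>M borel) (\<lambda>\<omega>. ((X 0 \<omega>, X n \<omega>), Z n \<omega>)) = D \<Otimes>\<^sub>M gauss"
    unfolding D_def pair(3) Z ..
  define h where "h q = \<phi> (fst (fst q), G (snd (fst q)) + \<sigma> *\<^sub>R snd q)" for q :: "('b \<times> 'b) \<times> 'b"
  have [measurable]: "h \<in> borel_measurable ((borel \<Otimes>\<^sub>M borel) \<Otimes>\<^sub>M borel)"
    unfolding h_def by measurable
  have "bounded_measurable (D \<Otimes>\<^sub>M gauss) h"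
    unfolding h_def by (rule bounded_measurable_compose[OF Suc.prems]) measurable
  then have h_int: "integrable (D \<Otimes>\<^sub>M gauss) h" by (rule DN.P.integrable_bounded_measurable)
  let ?\<phi> = "\<lambda>p. kernel_op G \<sigma> (\<lambda>z. \<phi> (fst p, z)) (snd p)"
  have \<phi>': "bounded_measurable (borel \<Otimes>\<^sub>M borel) ?\<phi>"
    by (rule bounded_measurable_kernel_op[OF pg G Suc.prems])
  have "expectation (\<lambda>\<omega>. \<phi> (X 0 \<omega>, X (Suc n) \<omega>)) = expectation (\<lambda>\<omega>. h ((X 0 \<omega>, X n \<omega>), Z n \<omega>))"
    by (simp add: step h_def)
  also have "\<dots> = integral\<^sup>L (D \<Otimes>\<^sub>M gauss) h"
    unfolding joint[symmetric] by (subst integral_distr) simp_all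
  also have "\<dots> = (\<integral>p. (\<integral>z. h (p, z) \<partial>gauss) \<partial>D)"
    by (rule DN.integral_fst'[OF h_int, symmetric])
  also have "\<dots> = (\<integral>p. ?\<phi> p \<partial>D)"
    by (simp add: h_def kernel_op_def)
  also have "\<dots> = expectation (\<lambda>\<omega>. ?\<phi> (X 0 \<omega>, X n \<omega>))"
    unfolding D_def using bounded_measurableD[OF \<phi>'] by (subst integral_distr) simp_all
  also have "\<dots> = expectation (\<lambda>\<omega>. (kernel_op G \<sigma> ^^ n) (\<lambda>z. ?\<phi> (X 0 \<omega>, z)) (X 0 \<omega>))"
    by (rule Suc.IH[OF \<phi>'])
  \<comment> \<open>The last step in time is the innermost operator, while \<open>funpow\<close>
    unfolds the outermost one.\<close>
  finally show ?case by (simp add: funpow_swap1)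
qed simp

text \<open>Bias-variance decomposition; averaging it once more, over x distributed as X, produces
  twice the variance.\<close>

lemma (in prob_space) expectation_square_dist:
  fixes X :: "'a \<Rightarrow> 'b::euclidean_space"
  assumes [measurable]: "X \<in> borel_measurable M" and X2: "integrable M (\<lambda>\<omega>. (norm (X \<omega>))\<^sup>2)"
  defines "m \<equiv> expectation X"
  shows "integrable M (\<lambda>\<omega>. (norm (x - X \<omega>))\<^sup>2)"
    and "expectation (\<lambda>\<omega>. (norm (x - X \<omega>))\<^sup>2) = (norm (x - m))\<^sup>2 + expectation (\<lambda>\<omega>. (norm (X \<omega> - m))\<^sup>2)"
proof -
  have X1: "integrable M X"
  proof (rule Bochner_Integration.integrable_bound)
    show "integrable M (\<lambda>\<omega>. 1 + (norm (X \<omega>))\<^sup>2)" using X2 by simp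
    have "t \<le> 1 + t\<^sup>2" for t :: real
      using zero_le_power2[of "t - 1"] zero_le_power2[of t] unfolding power2_diff one_power2 by linarith
    then show "AE \<omega> in M. norm (X \<omega>) \<le> norm (1 + (norm (X \<omega>))\<^sup>2)"
      by (intro AE_I2) (simp add: order_trans[OF _ abs_ge_self])
  qed simp
  have sq: "(norm (u - X \<omega>))\<^sup>2 = (norm u)\<^sup>2 - 2 * (u \<bullet> X \<omega>) + (norm (X \<omega>))\<^sup>2" for u \<omega>
    by (simp add: power2_norm_eq_inner inner_diff_left inner_diff_right inner_commute)
  show "integrable M (\<lambda>\<omega>. (norm (x - X \<omega>))\<^sup>2)" for x
    unfolding sq by (intro Bochner_Integration.integrable_add Bochner_Integration.integrable_diff
        integrable_mult_right integrable_inner_right X1 X2 integrable_const)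
  \<comment> \<open>Used at x and at m; the second moment cancels between the two.\<close>
  have e: "expectation (\<lambda>\<omega>. (norm (u - X \<omega>))\<^sup>2) = (norm u)\<^sup>2 - 2 * (u \<bullet> m) + expectation (\<lambda>\<omega>. (norm (X \<omega>))\<^sup>2)" for u
    unfolding sq m_def using X1 X2 by (simp add: prob_space)
  show "expectation (\<lambda>\<omega>. (norm (x - X \<omega>))\<^sup>2) = (norm (x - m))\<^sup>2 + expectation (\<lambda>\<omega>. (norm (X \<omega> - m))\<^sup>2)"
    unfolding norm_minus_commute[of "X _" m] e
    by (simp add: power2_norm_eq_inner inner_diff_left inner_diff_right inner_commute)
qed

text \<open>On the diagonal the operator reproduces the joint law, and averaging the second, free
  starting point over the law of \<open>X 0\<close> turns the \<open>n\<close>-step operator into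
  integration against the marginal law of \<open>X n\<close>. This is how the product of the
  marginals arises.\<close>

lemma (in prob_space) MI_le_if_log_Harnack:
  fixes X :: "nat \<Rightarrow> 'a \<Rightarrow> 'b::euclidean_space" and Z :: "nat \<Rightarrow> 'a \<Rightarrow> 'b"
  assumes pg: "prob_space (gauss :: 'b measure)" and G: "G \<in> borel_measurable borel"
    and indep: "indep_vars (\<lambda>_. borel) (\<lambda>i. case i of None \<Rightarrow> X 0 | Some j \<Rightarrow> Z j) UNIV"
    and step: "\<And>j \<omega>. X (Suc j) \<omega> = G (X j \<omega>) + \<sigma> *\<^sub>R Z j \<omega>"
    and Z: "\<And>j. distr M borel (Z j) = gauss"
    and X2: "integrable M (\<lambda>\<omega>. (norm (X 0 \<omega>))\<^sup>2)"
    and Harnack: "\<And>\<phi> x y. bounded_measurable borel \<phi> \<Longrightarrow>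
      (kernel_op G \<sigma> ^^ n) \<phi> x \<le> ln ((kernel_op G \<sigma> ^^ n) (\<lambda>z. exp (\<phi> z)) y) + C * (norm (x - y))\<^sup>2"
  shows "MI borel borel (distr M (borel \<Otimes>\<^sub>M borel) (\<lambda>\<omega>. (X 0 \<omega>, X n \<omega>)))
    \<le> ereal (2 * C * expectation (\<lambda>\<omega>. (norm (X 0 \<omega> - expectation (X 0)))\<^sup>2))"
proof -
  let ?T = "kernel_op G \<sigma> ^^ n"
  define m V where "m = expectation (X 0)" and "V = expectation (\<lambda>\<omega>. (norm (X 0 \<omega> - m))\<^sup>2)"
  have X_meas [measurable]: "X j \<in> borel_measurable M" for j
    using measurable_compose[OF distr_pair_noise(1)[where X = X and Z = Z and n = j, OF G indep step] measurable_snd]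
    by simp
  define \<rho> where "\<rho> = distr M (borel \<Otimes>\<^sub>M borel) (\<lambda>\<omega>. (X 0 \<omega>, X n \<omega>))"
  define P where "P j = distr M borel (X j)" for j
  have marg: "distr \<rho> borel fst = P 0" "distr \<rho> borel snd = P n"
    unfolding \<rho>_def P_def by (simp_all add: distr_distr comp_def)
  interpret \<rho>: prob_space \<rho> unfolding \<rho>_def by (rule prob_space_distr) simp
  interpret P: prob_space "P j" for j unfolding P_def by (rule prob_space_distr) simp
  interpret PP: pair_prob_space "P 0" "P n" ..
  have [measurable_cong]: "sets (P j) = sets borel" for j by (simp add: P_def)
  have "KL \<rho> (P 0 \<Otimes>\<^sub>M P n) \<le> ereal (2 * C * V)"
  proof (rule KL_le_if_Donsker_Varadhan)
    show "sets \<rho> = sets (P 0 \<Otimes>\<^sub>M P n)"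
      unfolding \<rho>_def P_def by (simp cong: sets_pair_measure_cong)
    fix \<phi> :: "'b \<times> 'b \<Rightarrow> real"
    assume "bounded_measurable (P 0 \<Otimes>\<^sub>M P n) \<phi>"
    then have \<phi>: "bounded_measurable (borel \<Otimes>\<^sub>M borel) \<phi>"
      unfolding bounded_measurable_def P_def by (simp cong: measurable_cong_sets sets_pair_measure_cong)
    note [measurable] = bounded_measurableD[OF \<phi>]
    have \<phi>x: "bounded_measurable borel (\<lambda>z. \<phi> (x, z))" for x
      by (rule bounded_measurable_compose[OF \<phi>]) simp
    have "bounded_measurable (borel \<Otimes>\<^sub>M borel) (\<lambda>p. ?T (\<lambda>z. \<phi> (fst p, z)) (snd p))"
      by (rule bounded_measurable_kernel_op_funpow[OF pg G \<phi>])
    from bounded_measurable_compose[OF this, of "\<lambda>x. (x, x)" borel]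
    have diag: "bounded_measurable borel (\<lambda>x. ?T (\<lambda>z. \<phi> (x, z)) x)" by simp
    have e_bm: "bounded_measurable M (\<lambda>\<omega>. exp (\<phi> (x, X n \<omega>)))" for x
      by (rule bounded_measurable_exp, rule bounded_measurable_compose[OF \<phi>]) simp
    have e_int: "integrable (P 0 \<Otimes>\<^sub>M P n) (\<lambda>p. exp (\<phi> p))"
      by (intro PP.integrable_bounded_measurable bounded_measurable_exp) fact
    have pw: "?T (\<lambda>z. \<phi> (x, z)) x \<le> (\<integral>z. exp (\<phi> (x, z)) \<partial>P n) - 1 + C * ((norm (x - m))\<^sup>2 + V)" for x
    proof -
      let ?e = "?T (\<lambda>z. exp (\<phi> (x, z)))"
      have "bounded_measurable borel ?e"
        by (intro bounded_measurable_kernel_op_funpow' pg G bounded_measurable_exp \<phi>x)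
      from bounded_measurable_compose[OF this X_meas[of 0]]
      have ei: "integrable M (\<lambda>\<omega>. ?e (X 0 \<omega>))" by (rule integrable_bounded_measurable)
      note d = expectation_square_dist[OF X_meas[of 0] X2, of x, folded m_def, folded V_def]
      \<comment> \<open>Replacing ln t by t - 1 makes the bound affine in the exponential term, so
        that averaging over \<open>y\<close> and then over \<open>x\<close> produces no further
        logarithm.\<close>
      have "?T (\<lambda>z. \<phi> (x, z)) x \<le> ?e y - 1 + C * (norm (x - y))\<^sup>2" for y
      proof -
        obtain c where "exp c \<le> ?e y" using kernel_op_funpow_exp_bounded_below[OF pg G \<phi>x, where \<sigma> = \<sigma> and n = n] by blast
        then have "0 < ?e y" by (rule less_le_trans[OF exp_gt_zero])
        then show ?thesis using Harnack[OF \<phi>x, of x x y] ln_le_minus_one[of "?e y"] by linarith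
      qed
      then have "expectation (\<lambda>\<omega>. ?T (\<lambda>z. \<phi> (x, z)) x)
          \<le> expectation (\<lambda>\<omega>. ?e (X 0 \<omega>) - 1 + C * (norm (x - X 0 \<omega>))\<^sup>2)"
        using ei d(1) by (intro integral_mono) auto
      also have "\<dots> = expectation (\<lambda>\<omega>. ?e (X 0 \<omega>)) - 1 + C * ((norm (x - m))\<^sup>2 + V)"
        using ei d by (simp add: prob_space)
      also have "expectation (\<lambda>\<omega>. ?e (X 0 \<omega>)) = expectation (\<lambda>\<omega>. exp (\<phi> (x, X n \<omega>)))"
      proof -
        have "bounded_measurable (borel \<Otimes>\<^sub>M borel) (\<lambda>p :: 'b \<times> 'b. exp (\<phi> (x, snd p)))"
          \<comment> \<open>\<open>x\<close> is a constant here: the test function depends only on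
            the current state.\<close>
          by (rule bounded_measurable_exp, rule bounded_measurable_compose[OF \<phi>]) simp
        from expectation_kernel_op_funpow[OF pg G indep step Z this, of n] show ?thesis by simp
      qed
      also have "\<dots> = (\<integral>z. exp (\<phi> (x, z)) \<partial>P n)"
        unfolding P_def by (subst integral_distr) simp_all
      finally show ?thesis by (simp add: prob_space)
    qed
    have i1: "integrable (P 0) (\<lambda>x. \<integral>z. exp (\<phi> (x, z)) \<partial>P n)"
      by (rule PP.integrable_fst'[OF e_int])
    have i2: "integrable (P 0) (\<lambda>x. (norm (x - m))\<^sup>2)" and V: "(\<integral>x. (norm (x - m))\<^sup>2 \<partial>P 0) = V"
      using expectation_square_dist(1)[OF X_meas[of 0] X2, of m]
      unfolding P_def V_def by (simp_all add: integrable_distr_eq integral_distr norm_minus_commute)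
    have "(\<integral>p. \<phi> p \<partial>\<rho>) = expectation (\<lambda>\<omega>. \<phi> (X 0 \<omega>, X n \<omega>))"
      unfolding \<rho>_def by (subst integral_distr) simp_all
    also have "\<dots> = expectation (\<lambda>\<omega>. ?T (\<lambda>z. \<phi> (X 0 \<omega>, z)) (X 0 \<omega>))"
      by (rule expectation_kernel_op_funpow[OF pg G indep step Z \<phi>])
    also have "\<dots> = (\<integral>x. ?T (\<lambda>z. \<phi> (x, z)) x \<partial>P 0)"
      unfolding P_def using bounded_measurableD[OF diag] by (subst integral_distr) simp_all
    also have "\<dots> \<le> (\<integral>x. (\<integral>z. exp (\<phi> (x, z)) \<partial>P n) - 1 + C * ((norm (x - m))\<^sup>2 + V) \<partial>P 0)"
    proof (rule integral_mono[OF _ _ pw])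
      have "bounded_measurable (P 0) (\<lambda>x. ?T (\<lambda>z. \<phi> (x, z)) x)"
        by (rule bounded_measurable_compose[OF diag]) simp
      then show "integrable (P 0) (\<lambda>x. ?T (\<lambda>z. \<phi> (x, z)) x)"
        by (rule P.integrable_bounded_measurable)
    qed (use i1 i2 in simp)
    also have "\<dots> = (\<integral>x. (\<integral>z. exp (\<phi> (x, z)) \<partial>P n) \<partial>P 0) - 1 + 2 * C * V"
      using i1 i2 by (simp add: V P.prob_space)
    also have "(\<integral>x. (\<integral>z. exp (\<phi> (x, z)) \<partial>P n) \<partial>P 0) = (\<integral>p. exp (\<phi> p) \<partial>(P 0 \<Otimes>\<^sub>M P n))"
      by (rule PP.integral_fst'[OF e_int])
    finally show "(\<integral>p. \<phi> p \<partial>\<rho>) \<le> (\<integral>p. exp (\<phi> p) \<partial>(P 0 \<Otimes>\<^sub>M P n)) - 1 + 2 * C * V" .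
  qed unfold_locales
  then show ?thesis unfolding MI_def \<rho>_def[symmetric] marg V_def m_def .
qed

section \<open>The Langevin iteration as an instance\<close>

theorem mainTheorem14:
  fixes f :: "'a::euclidean_space \<Rightarrow> real"
    and grad_f :: "'a \<Rightarrow> 'a"
    and H :: "'a \<Rightarrow> 'a \<Rightarrow> 'a"
    and \<alpha> L \<eta> :: real
    and M :: "'w measure"
    and X Z :: "nat \<Rightarrow> 'w \<Rightarrow> 'a"
    and k :: nat
  assumes grad: "\<And>x. (f has_derivative (\<lambda>h. grad_f x \<bullet> h)) (at x)"
    and hess: "\<And>x. (grad_f has_derivative H x) (at x)"
    and hess_cont: "\<And>v. continuous_on UNIV (\<lambda>x. H x v)"
    and strong_lc: "\<And>x v. \<alpha> * (norm v)\<^sup>2 \<le> v \<bullet> H x v"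
    and smooth: "\<And>x v. \<bar>v \<bullet> H x v\<bar> \<le> L * (norm v)\<^sup>2"
    and \<alpha>_pos: "0 < \<alpha>" and \<alpha>_le_L: "\<alpha> \<le> L"
    and \<eta>_pos: "0 < \<eta>" and \<eta>_le: "\<eta> \<le> 1 / L"
    and M: "prob_space M"
    and X0_meas: "X 0 \<in> borel_measurable M"
    and X0_second_moment: "integrable M (\<lambda>\<omega>. (norm (X 0 \<omega>))\<^sup>2)"
    and Z_gauss: "\<And>j. distributed M lborel (Z j) (\<lambda>x. ennreal (std_gauss_density x))"
    and indep: "prob_space.indep_vars M (\<lambda>_. borel)
                  (\<lambda>i. case i of None \<Rightarrow> X 0 | Some j \<Rightarrow> Z j) UNIV"
    and step: "\<And>j \<omega>. X (Suc j) \<omega> = X j \<omega> - \<eta> *\<^sub>R grad_f (X j \<omega>) + sqrt (2 * \<eta>) *\<^sub>R Z j \<omega>"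
    and k: "1 \<le> k"
  shows "MI borel borel (distr M (borel \<Otimes>\<^sub>M borel) (\<lambda>\<omega>. (X 0 \<omega>, X k \<omega>)))
         \<le> ereal (\<alpha> * (1 - \<alpha> * \<eta>) ^ (2 * k) / (1 - (1 - \<alpha> * \<eta>) ^ (2 * k))
                  * (\<integral>\<omega>. (norm (X 0 \<omega> - (\<integral>\<omega>'. X 0 \<omega>' \<partial>M)))\<^sup>2 \<partial>M))"
proof -
  interpret prob_space M by (fact M)
  define G where "G x = x - \<eta> *\<^sub>R grad_f x" for x
  define \<gamma> where "\<gamma> = 1 - \<alpha> * \<eta>"
  define \<sigma> where "\<sigma> = sqrt (2 * \<eta>)"
  have \<sigma>: "0 < \<sigma>" "\<sigma>\<^sup>2 = 2 * \<eta>" using \<eta>_pos by (simp_all add: \<sigma>_def)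
  have \<eta>L: "\<eta> * L \<le> 1" using \<eta>_le \<alpha>_pos \<alpha>_le_L by (simp add: field_simps)
  have "\<alpha> * \<eta> \<le> \<eta> * L" using \<alpha>_le_L \<eta>_pos by (simp add: mult.commute)
  \<comment> \<open>The case \<alpha> = L and \<eta> = 1 / L is included, and there \<gamma> is
    0.\<close>
  then have \<gamma>: "0 \<le> \<gamma>" "\<gamma> < 1"
    using \<eta>L mult_pos_pos[OF \<alpha>_pos \<eta>_pos] unfolding \<gamma>_def by linarith+
  have gauss_eq: "distr M borel (Z j) = gauss" for j
  proof -
    have "distr M borel (Z j) = distr M lborel (Z j)" by (rule distr_cong) simp_all
    also have "\<dots> = gauss" using Z_gauss[of j] by (simp add: distributed_def gauss_def)
    finally show ?thesis .
  qed
  have "Z 0 \<in> borel_measurable M" using Z_gauss[of 0] by (simp add: distributed_def)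
  then have pg: "prob_space (gauss :: 'a measure)"
    unfolding gauss_eq[of 0, symmetric] by (rule prob_space_distr)
  have dG: "(G has_derivative (\<lambda>v. v - \<eta> *\<^sub>R H x v)) (at x)" for x
    unfolding G_def by (auto intro!: derivative_eq_intros hess)
  have "continuous_on UNIV G"
    using dG by (auto intro!: continuous_at_imp_continuous_on has_derivative_continuous)
  then have Gm: "G \<in> borel_measurable borel" by (rule borel_measurable_continuous_onI)
  have lip: "norm (G x - G y) \<le> \<gamma> * norm (x - y)" for x y
  proof (rule lipschitz_if_derivative_between[OF _ dG])
    \<comment> \<open>\<open>G\<close> is the gradient of |x|^2 / 2 - \<eta> f, with Hessian I -
      \<eta> H. Smoothness with \<eta> L \<le> 1 makes its quadratic form nonnegative, and strong
      convexity bounds it by \<gamma>.\<close>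
    show "((\<lambda>x. x \<bullet> x / 2 - \<eta> * f x) has_derivative (\<lambda>h. G x \<bullet> h)) (at x)" for x
      unfolding G_def
      by (auto intro!: derivative_eq_intros grad simp: fun_eq_iff inner_diff_left inner_diff_right inner_commute)
    fix x v
    have "\<eta> * (v \<bullet> H x v) \<le> \<eta> * (L * (norm v)\<^sup>2)"
      using smooth[of v x] \<eta>_pos by (intro mult_left_mono) auto
    also have "\<dots> \<le> 1 * (norm v)\<^sup>2"
      unfolding mult.assoc[symmetric] by (rule mult_right_mono[OF \<eta>L]) simp
    finally show "0 \<le> v \<bullet> (v - \<eta> *\<^sub>R H x v)"
      by (simp add: inner_diff_right power2_norm_eq_inner)
    have "\<eta> * (\<alpha> * (norm v)\<^sup>2) \<le> \<eta> * (v \<bullet> H x v)"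
      using strong_lc[of v x] \<eta>_pos by (intro mult_left_mono) auto
    then show "v \<bullet> (v - \<eta> *\<^sub>R H x v) \<le> \<gamma> * (norm v)\<^sup>2"
      by (simp add: \<gamma>_def inner_diff_right power2_norm_eq_inner algebra_simps)
  qed
  \<comment> \<open>The shift price is 1 / (4 \<eta>), and 1 - \<gamma>^2 = \<alpha> \<eta> (2 -
    \<alpha> \<eta>).\<close>
  have "1 / (2 * \<sigma>\<^sup>2) * (1 - \<gamma>\<^sup>2) = \<alpha> / 2 - \<alpha> * \<alpha> * \<eta> / 4"
    unfolding \<sigma>(2) \<gamma>_def using \<eta>_pos by (simp add: field_simps power2_eq_square)
  also have "\<dots> \<le> \<alpha> / 2" using \<alpha>_pos \<eta>_pos by simp
  finally have \<alpha>: "1 / (2 * \<sigma>\<^sup>2) * (1 - \<gamma>\<^sup>2) \<le> \<alpha> / 2" .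
  have X_step: "X (Suc j) \<omega> = G (X j \<omega>) + \<sigma> *\<^sub>R Z j \<omega>" for j \<omega>
    by (simp add: step G_def \<sigma>_def)
  have half: "2 * (\<alpha> / 2 * g / (1 - g)) = \<alpha> * g / (1 - g)" for g :: real
    unfolding times_divide_eq_left times_divide_eq_right by simp
  from MI_le_if_log_Harnack[OF pg Gm indep X_step gauss_eq X0_second_moment
      kernel_op_log_Harnack[OF pg Gm lip \<gamma> \<sigma>(1) \<alpha> less_imp_le[OF \<alpha>_pos] k]]
  show ?thesis unfolding half \<gamma>_def .
qed

end
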